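(* Every connected quasi-$1$-plane is a bounded morphic image of a quasi-$2$-plane; that is, for every connected quasi-$1$-plane $\mathscr{F}$ there exist a quasi-$2$-plane $\mathscr{F}'$ and a surjective bounded morphism from $\mathscr{F}'$ to $\mathscr{F}$.
   Context: A $1$-frame is a pair $(X,I)$ with $I\subseteq X\times X$; $I^n$ is the $n$-fold composition of $I$. A quasi-$1$-plane is a $1$-frame in which $I$ is serial (every $a$ has some $b$ with $aIb$) and symmetric, and which satisfies: for all $a,b$, $aI^4b$ implies $aI^2b$. It is connected if any two elements are joined by a finite path $a_0I_+a_1I_+\cdots I_+a_n$, where $I_+=I\cup I^{-1}$. A $2$-frame is a triple $(P,L,I)$ with $P\cap L=\emptyset$ and $I\subseteq P\times L$ (elements of $P$ are points, of $L$ lines). A quasi-$2$-plane is a $2$-frame in which any two (not necessarily distinct) points have at least one line $\ell$ with both incident to $\ell$, and any two (not necessarily distinct) lines have at least one point incident to both. A bounded morphism from a $2$-frame $(P,L,I)$ to a $1$-frame $(X',I')$ is a function $\theta:P\cup L\to X'$ such that: (F) for $a\in P$, $b\in L$, $aIb$ implies $\theta(a)I'\theta(b)$; (B1) for $a\in P$, $b'\in X'$, if $\theta(a)I'b'$ then there is $b\in L$ with $aIb$ and $\theta(b)=b'$; (B2) for $a'\in X'$, $b\in L$, if $a'I'\theta(b)$ then there is $a\in P$ with $aIb$ and $\theta(a)=a'$. *)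

theory Defs
  imports Main
begin

text \<open>The carrier of a frame may be empty; connectedness is then vacuous.\<close>

definition one_frame :: "'a set \<Rightarrow> 'a rel \<Rightarrow> bool" where
  "one_frame X I \<longleftrightarrow> I \<subseteq> X \<times> X"

definition quasi_one_plane :: "'a set \<Rightarrow> 'a rel \<Rightarrow> bool" where
  "quasi_one_plane X I \<longleftrightarrow>
     one_frame X I \<and>
     (\<forall>a\<in>X. \<exists>b\<in>X. (a, b) \<in> I) \<and>
     sym I \<and>
     (\<forall>a\<in>X. \<forall>b\<in>X. (a, b) \<in> I ^^ 4 \<longrightarrow> (a, b) \<in> I ^^ 2)"

text \<open>In a 1-frame a path starting in \<open>X\<close> stays in \<open>X\<close>, since \<open>I \<subseteq> X \<times> X\<close>.\<close>

definition connected_frame :: "'a set \<Rightarrow> 'a rel \<Rightarrow> bool" where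
  "connected_frame X I \<longleftrightarrow> (\<forall>a\<in>X. \<forall>b\<in>X. (a, b) \<in> (I \<union> I\<inverse>)\<^sup>*)"

definition two_frame :: "'b set \<Rightarrow> 'b set \<Rightarrow> 'b rel \<Rightarrow> bool" where
  "two_frame P L I \<longleftrightarrow> P \<inter> L = {} \<and> I \<subseteq> P \<times> L"

definition quasi_two_plane :: "'b set \<Rightarrow> 'b set \<Rightarrow> 'b rel \<Rightarrow> bool" where
  "quasi_two_plane P L I \<longleftrightarrow>
     two_frame P L I \<and>
     (\<forall>p\<in>P. \<forall>q\<in>P. \<exists>l\<in>L. (p, l) \<in> I \<and> (q, l) \<in> I) \<and>
     (\<forall>l\<in>L. \<forall>m\<in>L. \<exists>p\<in>P. (p, l) \<in> I \<and> (p, m) \<in> I)"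

text \<open>The conjuncts after the typing of \<open>\<theta>\<close> are the conditions (F), (B1) and (B2).\<close>

definition bounded_morphism ::
  "'b set \<Rightarrow> 'b set \<Rightarrow> 'b rel \<Rightarrow> 'a set \<Rightarrow> 'a rel \<Rightarrow> ('b \<Rightarrow> 'a) \<Rightarrow> bool" where
  "bounded_morphism P L I X' I' \<theta> \<longleftrightarrow>
     \<theta> ` (P \<union> L) \<subseteq> X' \<and>
     (\<forall>a\<in>P. \<forall>b\<in>L. (a, b) \<in> I \<longrightarrow> (\<theta> a, \<theta> b) \<in> I') \<and>
     (\<forall>a\<in>P. \<forall>b'\<in>X'. (\<theta> a, b') \<in> I' \<longrightarrow> (\<exists>b\<in>L. (a, b) \<in> I \<and> \<theta> b = b')) \<and>
     (\<forall>a'\<in>X'. \<forall>b\<in>L. (a', \<theta> b) \<in> I' \<longrightarrow> (\<exists>a\<in>P. (a, b) \<in> I \<and> \<theta> a = a'))"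

text \<open>
  HOL cannot quantify existentially over types, so an existence claim about 2-frames has to name
  the type in which points and lines live. For a 1-frame over \<open>'a\<close> we use \<open>'a + 'a\<close>. This can only
  strengthen the claim. Points and lines are arbitrary disjoint subsets of that type; in particular
  they are not tied to the two summands.
\<close>

end

(* By symmetry, seriality and the axiom on paths of length four, the relation "joined by a path of
   length two" is an equivalence. Take as points one of its classes A, and as lines a tagged copy of
   the set B of all neighbours of A. Then neighbours of B lie in A again, so by connectedness A and B
   together exhaust the frame (A = B if the frame contains an odd cycle, A and B are the two sides
   otherwise), and two elements on the same side always have a common neighbour on the other side. *)
theory Submission imports Defs begin

text \<open>The right side is transitivity of \<open>I O I\<close>, the form in which the axiom is
  applied.\<close>

lemma relpow_4_le_2_iff: "(I ^^ 4 \<subseteq> I ^^ 2) \<longleftrightarrow> (I O I) O (I O I) \<subseteq> I O I"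
  by (simp add: numeral_eq_Suc O_assoc)

theorem theorem3p4:
  fixes X :: "'a set" and I :: "'a rel"
  assumes "quasi_one_plane X I" and "connected_frame X I"
  shows "\<exists>(P :: ('a + 'a) set) (L :: ('a + 'a) set) (J :: ('a + 'a) rel) (\<theta> :: 'a + 'a \<Rightarrow> 'a).
           quasi_two_plane P L J \<and> bounded_morphism P L J X I \<theta> \<and> \<theta> ` (P \<union> L) = X"
proof (cases "X = {}")
  case True
  then show ?thesis
    by (intro exI[of _ "{}"]) (simp add: quasi_two_plane_def two_frame_def bounded_morphism_def)
next
  case False
  then obtain x where x: "x \<in> X" by blast
  have IX: "I \<subseteq> X \<times> X" and serial: "\<And>a. a \<in> X \<Longrightarrow> \<exists>b. (a, b) \<in> I"
    and sym: "\<And>a b. (a, b) \<in> I \<Longrightarrow> (b, a) \<in> I"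
    and four: "\<And>a b. a \<in> X \<Longrightarrow> b \<in> X \<Longrightarrow> (a, b) \<in> I ^^ 4 \<Longrightarrow> (a, b) \<in> I ^^ 2"
    using assms(1) unfolding quasi_one_plane_def one_frame_def by (blast dest: symD)+
  \<comment> \<open>The axiom speaks only of pairs from \<open>X\<close>; this lifts it to all
    pairs.\<close>
  have "I ^^ 4 \<subseteq> X \<times> X" using IX by (auto simp: numeral_eq_Suc)
  then have "(I O I) O (I O I) \<subseteq> I O I"
    using four relpow_4_le_2_iff[of I] by blast
  then have shorten: "\<exists>m. (a, m) \<in> I \<and> (m, e) \<in> I"
    if "(a, b) \<in> I" "(b, c) \<in> I" "(c, d) \<in> I" "(d, e) \<in> I" for a b c d e
    using that by blast
  define A where "A = {a. \<exists>m. (x, m) \<in> I \<and> (m, a) \<in> I}"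
  define B where "B = I `` A"
  have AX: "A \<subseteq> X" and BX: "B \<subseteq> X" using IX by (auto simp: A_def B_def)
  have AB: "b \<in> B" if "a \<in> A" "(a, b) \<in> I" for a b using that by (auto simp: B_def)
  \<comment> \<open>Some path \<open>x, m, a', b, a\<close> with \<open>a'\<close> in
    \<open>A\<close> has length four and shortens to two.\<close>
  have BA: "a \<in> A" if "b \<in> B" "(b, a) \<in> I" for a b
    using that shorten by (fastforce simp: A_def B_def)
  have common_A: "\<exists>b\<in>B. (p, b) \<in> I \<and> (q, b) \<in> I" if pq: "p \<in> A" "q \<in> A" for p q
  proof -
    obtain m n where "(x, m) \<in> I" "(m, p) \<in> I" "(x, n) \<in> I" "(n, q) \<in> I"
      using pq by (auto simp: A_def)
    \<comment> \<open>Shorten the path \<open>p, m, x, n, q\<close>.\<close>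
    then obtain b where "(p, b) \<in> I" "(b, q) \<in> I" using shorten sym by meson
    then show ?thesis using AB pq sym by blast
  qed
  have common_B: "\<exists>a\<in>A. (a, l) \<in> I \<and> (a, m) \<in> I" if lm: "l \<in> B" "m \<in> B" for l m
  proof -
    obtain p q where pq: "p \<in> A" "(p, l) \<in> I" "q \<in> A" "(q, m) \<in> I"
      using lm by (auto simp: B_def)
    with common_A obtain b where "(p, b) \<in> I" "(q, b) \<in> I" by blast
    \<comment> \<open>Shorten the path \<open>l, p, b, q, m\<close>.\<close>
    with pq obtain a where "(l, a) \<in> I" "(a, m) \<in> I" using shorten sym by meson
    then show ?thesis using BA lm sym by blast
  qed
  have "y \<in> A \<union> B" if "y \<in> X" for y
  proof -
    have "(x, y) \<in> (I \<union> I\<inverse>)\<^sup>*" using assms(2) x that by (simp add: connected_frame_def)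
    then show ?thesis
    proof induction
      case base
      \<comment> \<open>Going to a neighbour of \<open>x\<close> and back puts \<open>x\<close> in
        \<open>A\<close>.\<close>
      show ?case using serial[OF x] sym by (auto simp: A_def)
    next
      case (step y z)
      then show ?case using AB BA sym by blast
    qed
  qed
  then have cover: "A \<union> B = X" using AX BX by blast
  \<comment> \<open>The tags keep points and lines disjoint even if \<open>A\<close> and
    \<open>B\<close> overlap.\<close>
  define J :: "('a + 'a) rel" where "J = {(Inl a, Inr b) | a b. a \<in> A \<and> b \<in> B \<and> (a, b) \<in> I}"
  define \<theta> :: "'a + 'a \<Rightarrow> 'a" where "\<theta> = case_sum id id"
  have "quasi_two_plane (Inl ` A) (Inr ` B) J"
    using common_A common_B by (auto simp: quasi_two_plane_def two_frame_def J_def)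
  \<comment> \<open>\<open>AB\<close> gives (B1); \<open>BA\<close> with symmetry gives
    (B2).\<close>
  moreover have "bounded_morphism (Inl ` A) (Inr ` B) J X I \<theta>"
    using AX BX AB BA sym by (auto simp: bounded_morphism_def J_def \<theta>_def)
  moreover have "\<theta> ` (Inl ` A \<union> Inr ` B) = X"
    using cover by (simp add: \<theta>_def image_Un image_image)
  ultimately show ?thesis by blast
qed

end
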